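(* $(\tilde{\mathbb{I}},\wedge,\vee,\neg)$ is a Kleene algebra, where $\wedge$ and $\vee$ are the infimum and supremum operations under the order $\leq_{\mathrm{XY}}$, respectively.
   Context: $\tilde{\mathbb{I}}=\{\langle\mu,\nu\rangle\in[0,1]^2 \mid \mu+\nu\le 1\}$ is the set of intuitionistic fuzzy values. For $\alpha=\langle\mu_\alpha,\nu_\alpha\rangle\in\tilde{\mathbb{I}}$ put $s(\alpha)=\mu_\alpha-\nu_\alpha$ and $h(\alpha)=\mu_\alpha+\nu_\alpha$. Define $\alpha<_{\mathrm{XY}}\beta$ iff $s(\alpha)<s(\beta)$, or $s(\alpha)=s(\beta)$ and $h(\alpha)<h(\beta)$; $\alpha\leq_{\mathrm{XY}}\beta$ iff $\alpha<_{\mathrm{XY}}\beta$ or $\alpha=\beta$. The bottom and top elements under $\leq_{\mathrm{XY}}$ are $\langle 0,1\rangle$ and $\langle 1,0\rangle$. The operator $\neg:\tilde{\mathbb{I}}\to\tilde{\mathbb{I}}$ is $$\neg\alpha=\begin{cases}\left\langle\frac{1-\mu_\alpha-\nu_\alpha}{2},\frac{1+\mu_\alpha-3\nu_\alpha}{2}\right\rangle, & \mu_\alpha>\nu_\alpha,\\ \left\langle\frac12-\mu_\alpha,\frac12-\nu_\alpha\right\rangle, & \mu_\alpha=\nu_\alpha,\\ \left\langle\frac{1+\nu_\alpha-3\mu_\alpha}{2},\frac{1-\mu_\alpha-\nu_\alpha}{2}\right\rangle, & \mu_\alpha<\nu_\alpha.\end{cases}$$ A strong negation on a bounded lattice $L$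 is a decreasing map $N:L\to L$ with $N(\mathbf{0})=\mathbf{1}$, $N(\mathbf{1})=\mathbf{0}$ and $N(N(x))=x$ for all $x$. A De Morgan algebra is a bounded distributive lattice with a strong negation. A Kleene algebra is a De Morgan algebra $(L,\vee,\wedge,\neg)$ satisfying Kleene's inequality $x\wedge(\neg x)\preceq y\vee(\neg y)$ for all $x,y\in L$. *)

theory Defs
  imports Complex_Main "HOL-Algebra.Lattice"
begin

section \<open>De Morgan and Kleene algebras\<close>

text \<open>Lattices are those of HOL-Algebra: the order determines \<open>\<sqinter>\<close> and \<open>\<squnion>\<close> as the infimum
  and supremum of two elements, and \<open>\<bottom>\<close> and \<open>\<top>\<close> as the least and greatest element.\<close>

locale distributive_lattice = lattice +
  assumes meet_join_distrib:
    "\<lbrakk>x \<in> carrier L; y \<in> carrier L; z \<in> carrier L\<rbrakk> \<Longrightarrow> x \<sqinter> (y \<squnion> z) = (x \<sqinter> y) \<squnion> (x \<sqinter> z)"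

locale bounded_distributive_lattice = bounded_lattice + distributive_lattice

locale strong_negation = bounded_lattice L for L (structure) +
  fixes N :: "'a \<Rightarrow> 'a"
  assumes neg_closed: "N \<in> carrier L \<rightarrow> carrier L"
    and neg_decreasing: "\<lbrakk>x \<in> carrier L; y \<in> carrier L; x \<sqsubseteq> y\<rbrakk> \<Longrightarrow> N y \<sqsubseteq> N x"
    and neg_bottom: "N \<bottom> = \<top>"
    and neg_top: "N \<top> = \<bottom>"
    and neg_involutive: "x \<in> carrier L \<Longrightarrow> N (N x) = x"

locale de_morgan_algebra = bounded_distributive_lattice L + strong_negation L N
  for L (structure) and N

locale kleene_algebra = de_morgan_algebra L N
  for L (structure) and N +
  assumes kleene_inequality:
    "\<lbrakk>x \<in> carrier L; y \<in> carrier L\<rbrakk> \<Longrightarrow> x \<sqinter> N x \<sqsubseteq> y \<squnion> N y"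


section \<open>Intuitionistic fuzzy values\<close>

text \<open>A pair \<open>(\<mu>, \<nu>)\<close> stands for \<open>\<langle>\<mu>, \<nu>\<rangle>\<close>.\<close>

definition ifvs :: "(real \<times> real) set" where
  "ifvs = {(\<mu>, \<nu>). \<mu> \<in> {0..1} \<and> \<nu> \<in> {0..1} \<and> \<mu> + \<nu> \<le> 1}"

definition score :: "real \<times> real \<Rightarrow> real" where
  "score = (\<lambda>(\<mu>, \<nu>). \<mu> - \<nu>)"

definition accuracy :: "real \<times> real \<Rightarrow> real" where
  "accuracy = (\<lambda>(\<mu>, \<nu>). \<mu> + \<nu>)"

definition less_XY :: "real \<times> real \<Rightarrow> real \<times> real \<Rightarrow> bool" (infix \<open><\<^sub>X\<^sub>Y\<close> 50) where
  "\<alpha> <\<^sub>X\<^sub>Y \<beta> \<longleftrightarrow> score \<alpha> < score \<beta> \<or> (score \<alpha> = score \<beta> \<and> accuracy \<alpha> < accuracy \<beta>)"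

definition le_XY :: "real \<times> real \<Rightarrow> real \<times> real \<Rightarrow> bool" (infix \<open>\<le>\<^sub>X\<^sub>Y\<close> 50) where
  "\<alpha> \<le>\<^sub>X\<^sub>Y \<beta> \<longleftrightarrow> \<alpha> <\<^sub>X\<^sub>Y \<beta> \<or> \<alpha> = \<beta>"

definition ifv_order :: "(real \<times> real) gorder" where
  "ifv_order = \<lparr>carrier = ifvs, eq = (=), le = (\<le>\<^sub>X\<^sub>Y)\<rparr>"

definition ifv_neg :: "real \<times> real \<Rightarrow> real \<times> real" where
  "ifv_neg = (\<lambda>(\<mu>, \<nu>).
     if \<mu> > \<nu> then ((1 - \<mu> - \<nu>) / 2, (1 + \<mu> - 3 * \<nu>) / 2)
     else if \<mu> = \<nu> then (1 / 2 - \<mu>, 1 / 2 - \<nu>)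
     else ((1 + \<nu> - 3 * \<mu>) / 2, (1 - \<mu> - \<nu>) / 2))"

end

theory Submission
  imports Defs
begin

text \<open>In the coordinates \<open>(s, h)\<close> = (score, accuracy) the set of values is
  \<open>\<bar>s\<bar> \<le> h \<le> 1\<close>, the order is lexicographic, and the negation becomes
  \<open>(s, h) \<mapsto> (- s, 1 + \<bar>s\<bar> - h)\<close>, which is visibly an order-reversing involution. A total order
  is a distributive lattice, and Kleene's inequality holds because the fixed point
  \<open>\<langle>1/4, 1/4\<rangle>\<close> of the negation separates \<open>x \<sqinter> \<not> x\<close> from \<open>y \<squnion> \<not> y\<close>.\<close>

text \<open>Of two comparable elements the join is the larger one, and meeting with \<open>x\<close>
  is monotone, so it preserves that join.\<close>

lemma (in total_order) total_order_distributive_lattice: "distributive_lattice L"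
proof
  fix x y z
  assume L: "x \<in> carrier L" "y \<in> carrier L" "z \<in> carrier L"
  have join_absorb: "a \<squnion> b = b" if "a \<sqsubseteq> b" "a \<in> carrier L" "b \<in> carrier L" for a b
    using that by (intro le_antisym join_le join_right) auto
  have mono: "x \<sqinter> a \<sqsubseteq> x \<sqinter> b" if "a \<sqsubseteq> b" "a \<in> carrier L" "b \<in> carrier L" for a b
    using that L(1) le_trans[OF meet_right[of x a]] by (intro meet_le meet_left) auto
  show "x \<sqinter> (y \<squnion> z) = (x \<sqinter> y) \<squnion> (x \<sqinter> z)"
    using total_order_total[OF L(2,3)]
  proof
    assume "y \<sqsubseteq> z"
    then show ?thesis using L by (simp add: join_absorb mono)
  next
    assume "z \<sqsubseteq> y"
    then show ?thesis
      using L by (simp add: join_absorb mono join_comm[of _ y] join_comm[of _ "x \<sqinter> y"])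
  qed
qed

text \<open>The two conditions on \<open>c\<close> hold in particular for a fixed point of a decreasing \<open>N\<close>.\<close>

lemma (in total_order) kleene_inequality_of_separating_element:
  assumes "x \<in> carrier L" "y \<in> carrier L" "c \<in> carrier L" "N \<in> carrier L \<rightarrow> carrier L"
    and above: "\<And>x. \<lbrakk>x \<in> carrier L; c \<sqsubseteq> x\<rbrakk> \<Longrightarrow> N x \<sqsubseteq> c"
    and below: "\<And>x. \<lbrakk>x \<in> carrier L; x \<sqsubseteq> c\<rbrakk> \<Longrightarrow> c \<sqsubseteq> N x"
  shows "x \<sqinter> N x \<sqsubseteq> y \<squnion> N y"
proof -
  have N: "N x \<in> carrier L" "N y \<in> carrier L"
    using assms by auto
  \<comment> \<open>By totality one of the two factors is below \<open>c\<close>: either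
    \<open>x\<close> itself, or \<open>N x\<close> when \<open>c\<close> is below \<open>x\<close>.
    The bound on the join is dual.\<close>
  have "x \<sqinter> N x \<sqsubseteq> c"
    using total_order_total[of x c] above[of x] assms(1,3) N
      le_trans[OF meet_left[of x "N x"], of c] le_trans[OF meet_right[of x "N x"], of c]
    by auto
  moreover have "c \<sqsubseteq> y \<squnion> N y"
    using total_order_total[of y c] below[of y] assms(2,3) N
      le_trans[OF _ join_left[of y "N y"], of c] le_trans[OF _ join_right[of y "N y"], of c]
    by auto
  ultimately show ?thesis
    using le_trans[of "x \<sqinter> N x" c "y \<squnion> N y"] assms(1-3) N by simp
qed

text \<open>Accuracy plus or minus score is twice a component, so the left inequality is
  nonnegativity of both components; their upper bound 1 then follows from the right one.\<close>

lemma ifvs_iff: "\<alpha> \<in> ifvs \<longleftrightarrow> \<bar>score \<alpha>\<bar> \<le> accuracy \<alpha> \<and> accuracy \<alpha> \<le> 1"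
  by (cases \<alpha>) (auto simp: ifvs_def score_def accuracy_def)

text \<open>The change of coordinates is linear and invertible.\<close>

lemma ifv_eq_iff: "\<alpha> = \<beta> \<longleftrightarrow> score \<alpha> = score \<beta> \<and> accuracy \<alpha> = accuracy \<beta>"
  by (cases \<alpha>; cases \<beta>) (auto simp: score_def accuracy_def)

lemma le_XY_iff:
  "\<alpha> \<le>\<^sub>X\<^sub>Y \<beta> \<longleftrightarrow> score \<alpha> < score \<beta> \<or> (score \<alpha> = score \<beta> \<and> accuracy \<alpha> \<le> accuracy \<beta>)"
  by (auto simp: le_XY_def less_XY_def ifv_eq_iff)

lemma score_ifv_neg [simp]: "score (ifv_neg \<alpha>) = - score \<alpha>"
  by (cases \<alpha>) (auto simp: score_def ifv_neg_def field_simps)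

text \<open>The absolute value merges the three branches. At score \<open>s\<close>, the map
  reflects the interval from \<bar>s\<bar> to 1 of admissible accuracies; this gives closure and
  involutivity.\<close>

lemma accuracy_ifv_neg [simp]: "accuracy (ifv_neg \<alpha>) = 1 + \<bar>score \<alpha>\<bar> - accuracy \<alpha>"
  by (cases \<alpha>) (auto simp: score_def accuracy_def ifv_neg_def field_simps)

lemma ifv_neg_closed: "ifv_neg \<in> ifvs \<rightarrow> ifvs"
  by (auto simp: ifvs_iff)

lemma ifv_neg_involutive: "ifv_neg (ifv_neg \<alpha>) = \<alpha>"
  by (simp add: ifv_eq_iff)

text \<open>The score changes sign; at equal scores the reflection is the same for both values and
  reverses their accuracies.\<close>

lemma ifv_neg_decreasing: "\<alpha> \<le>\<^sub>X\<^sub>Y \<beta> \<Longrightarrow> ifv_neg \<beta> \<le>\<^sub>X\<^sub>Y ifv_neg \<alpha>"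
  by (auto simp: le_XY_iff)

text \<open>Scores lie between -1 and 1, and a score of -1 forces accuracy 1.\<close>

lemma ifv_bottom: "(0, 1) \<in> ifvs" "\<alpha> \<in> ifvs \<Longrightarrow> (0, 1) \<le>\<^sub>X\<^sub>Y \<alpha>"
  by (auto simp: ifvs_iff le_XY_iff) (auto simp: score_def accuracy_def)

lemma ifv_top: "(1, 0) \<in> ifvs" "\<alpha> \<in> ifvs \<Longrightarrow> \<alpha> \<le>\<^sub>X\<^sub>Y (1, 0)"
  by (auto simp: ifvs_iff le_XY_iff) (auto simp: score_def accuracy_def)

lemma ifv_order_simps [simp]:
  "carrier ifv_order = ifvs" "eq ifv_order = (=)" "le ifv_order = (\<le>\<^sub>X\<^sub>Y)"
  by (simp_all add: ifv_order_def)

lemma total_order_ifv_order: "total_order ifv_order"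
  by standard (auto simp: le_XY_iff ifv_eq_iff)

lemma bounded_lattice_ifv_order: "bounded_lattice ifv_order"
proof -
  interpret total_order ifv_order by (rule total_order_ifv_order)
  show ?thesis
  proof
    show "\<exists>x. least ifv_order x (carrier ifv_order)"
      using ifv_bottom by (intro exI[of _ "(0, 1)"]) (auto simp: least_def Lower_def Upper_def)
    show "\<exists>x. greatest ifv_order x (carrier ifv_order)"
      using ifv_top by (intro exI[of _ "(1, 0)"]) (auto simp: greatest_def Lower_def Upper_def)
  qed
qed

theorem theorem4p3:
  shows "kleene_algebra ifv_order ifv_neg"
proof -
  interpret total_order ifv_order by (rule total_order_ifv_order)
  interpret bounded_lattice ifv_order by (rule bounded_lattice_ifv_order)
  interpret distributive_lattice ifv_order by (rule total_order_distributive_lattice)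
  have bottom: "\<bottom>\<^bsub>ifv_order\<^esub> = (0, 1)"
    using bottom_eq[of "(0, 1)"] ifv_bottom by simp
  have top: "\<top>\<^bsub>ifv_order\<^esub> = (1, 0)"
    using top_eq[of "(1, 0)"] ifv_top by simp
  \<comment> \<open>A fixed point needs score 0, and then accuracy \<open>h\<close> with
    \<open>h = 1 - h\<close>, which leaves only this pair.\<close>
  have fixpoint: "(1/4, 1/4) \<in> ifvs" "ifv_neg (1/4, 1/4) = (1/4, 1/4)"
    by (simp_all add: ifvs_def ifv_neg_def)
  show ?thesis
  proof
    show "ifv_neg \<in> carrier ifv_order \<rightarrow> carrier ifv_order"
      using ifv_neg_closed by simp
    show "ifv_neg \<bottom>\<^bsub>ifv_order\<^esub> = \<top>\<^bsub>ifv_order\<^esub>" "ifv_neg \<top>\<^bsub>ifv_order\<^esub> = \<bottom>\<^bsub>ifv_order\<^esub>"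
      by (simp_all add: bottom top ifv_neg_def)
    fix x y
    show "ifv_neg (ifv_neg x) = x"
      by (rule ifv_neg_involutive)
    show "ifv_neg y \<sqsubseteq>\<^bsub>ifv_order\<^esub> ifv_neg x" if "x \<sqsubseteq>\<^bsub>ifv_order\<^esub> y"
      using that by (simp add: ifv_neg_decreasing)
    show "x \<sqinter>\<^bsub>ifv_order\<^esub> ifv_neg x \<sqsubseteq>\<^bsub>ifv_order\<^esub> y \<squnion>\<^bsub>ifv_order\<^esub> ifv_neg y"
      if "x \<in> carrier ifv_order" "y \<in> carrier ifv_order"
      using that
    proof (rule kleene_inequality_of_separating_element)
      show "(1/4, 1/4) \<in> carrier ifv_order"
        using fixpoint by simp
      show "ifv_neg \<in> carrier ifv_order \<rightarrow> carrier ifv_order"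
        using ifv_neg_closed by simp
      fix z
      show "ifv_neg z \<sqsubseteq>\<^bsub>ifv_order\<^esub> (1/4, 1/4)" if "(1/4, 1/4) \<sqsubseteq>\<^bsub>ifv_order\<^esub> z"
        using ifv_neg_decreasing[of "(1/4, 1/4)" z] that fixpoint by simp
      show "(1/4, 1/4) \<sqsubseteq>\<^bsub>ifv_order\<^esub> ifv_neg z" if "z \<sqsubseteq>\<^bsub>ifv_order\<^esub> (1/4, 1/4)"
        using ifv_neg_decreasing[of z "(1/4, 1/4)"] that fixpoint by simp
    qed
  qed
qed

end
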